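(* Let $V:\mathbb R\to\mathbb R$ and put $g:=V'$. Assume (V1) $V\in C^2(\mathbb R)\cap C^3(\mathbb R\setminus\{0\})$ is even, $V(0)=0$, and $Z_V:=\int_{\mathbb R}e^{-V(x)}\,dx<\infty$; (V2) $g(x)>0$ for $x>0$ and $g'(x)\ge0$ for all $x\in\mathbb R$. Let $p:=Z_V^{-1}e^{-V}$, $p_0:=p(0)$, $F(x):=\int_{-\infty}^xp(t)\,dt$, $m(x):=F(x)/p(x)$ for $x\in\mathbb R$, and for $z\in\mathbb R$ let $$f_z(x)=\begin{cases}\dfrac{F(x)(1-F(z))}{p(x)},&x\le z,\\[2mm]\dfrac{F(z)(1-F(x))}{p(x)},&x>z.\end{cases}$$ Let $C_{\mathrm K}(V):=\sup_{z\in\mathbb R}\|f_z\|_\infty$. (a) For every $z\in\mathbb R$, $$\|f_z'\|_\infty\le1,\qquad \|g f_z\|_\infty\le\max\{F(z),1-F(z)\}\le1 .$$ Moreover, for every $a>0$, $$\frac1{4p_0}\le C_{\mathrm K}(V)\le\max\left\{\frac{e^{V(a)}}{4p_0},\frac1{g(a)}\right\};$$ equivalently (for the upper bound), $C_{\mathrm K}(V)\le B_V:=\inf_{a>0}\max\left\{\frac{e^{V(a)}}{4p_0},\frac1{g(a)}\right\}<\infty$. (b) If in addition (V3) $2(g'(x))^2-g(x)g''(x)\ge0$ for all $x\in\mathbb R\setminus\{0\}$, then for every $z\in\mathbb R$ the function $x\mapsto g(x)f_z(x)$ is nondecreasing on $\mathbb R$, and $$\|g f_z\|_\infty=\max\{F(z),1-F(z)\},\qquad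 \|f_z'\|_\infty=\max\bigl\{(1-F(z))m'(z),\;F(z)m'(-z)\bigr\}.$$ Consequently, $$\sup_{z\in\mathbb R}\|f_z'\|_\infty=1,\qquad \sup_{z\in\mathbb R}\|g f_z\|_\infty=1 .$$ (c) Assume (V1)--(V2) (not necessarily (V3)) and, with $K(x):=4p_0\{2F(x)-1\}-g(x)$ for $x>0$, assume that there is $x_*>0$ such that $K>0$ on $(0,x_* )$, $K(x_* )=0$, and $K<0$ on $(x_*,\infty)$. Then $$C_{\mathrm K}(V)=\frac1{4p(0)} .$$
   Context: $\|\cdot\|_\infty$ denotes the supremum norm over $x\in\mathbb R$. The function $f_z$ is the bounded solution of the Stein equation $f_z'(x)-g(x)f_z(x)=\mathbf 1_{(-\infty,z]}(x)-F(z)$; its derivative $f_z'$ is understood on $\mathbb R\setminus\{z\}$, and $\|f_z'\|_\infty$ is the essential supremum of $|f_z'|$, equivalently its supremum over $\mathbb R\setminus\{z\}$. *)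

theory Defs
  imports "HOL-Analysis.Analysis"
begin

text \<open>
  \<open>C_class k S f\<close> says that \<open>f\<close> is of class \<open>C\<^sup>k\<close> on the open set \<open>S\<close>. The derivatives are taken by
  \<^const>\<open>deriv\<close> on the whole line; since \<open>S\<close> is open, their values on \<open>S\<close> depend only on \<open>f\<close> near
  the point. Only meant for open \<open>S\<close>.
\<close>

definition C_class :: "nat \<Rightarrow> real set \<Rightarrow> (real \<Rightarrow> real) \<Rightarrow> bool" where
  "C_class k S f \<longleftrightarrow>
     (\<forall>i<k. (deriv ^^ i) f differentiable_on S) \<and> continuous_on S ((deriv ^^ k) f)"

definition cond_V1 :: "(real \<Rightarrow> real) \<Rightarrow> bool" where
  "cond_V1 V \<longleftrightarrow>
     C_class 2 UNIV V \<and> C_class 3 (UNIV - {0}) V \<and> (\<forall>x. V (- x) = V x) \<and> V 0 = 0 \<and>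
     integrable lborel (\<lambda>x. exp (- V x))"

definition cond_V2 :: "(real \<Rightarrow> real) \<Rightarrow> bool" where
  "cond_V2 V \<longleftrightarrow> (\<forall>x>0. deriv V x > 0) \<and> (\<forall>x. deriv (deriv V) x \<ge> 0)"

definition cond_V3 :: "(real \<Rightarrow> real) \<Rightarrow> bool" where
  "cond_V3 V \<longleftrightarrow>
     (\<forall>x\<in>UNIV - {0}. 2 * (deriv (deriv V) x)\<^sup>2 - deriv V x * deriv (deriv (deriv V)) x \<ge> 0)"

definition Z_V :: "(real \<Rightarrow> real) \<Rightarrow> real" where
  "Z_V V = (\<integral>x. exp (- V x) \<partial>lborel)"

definition p_V :: "(real \<Rightarrow> real) \<Rightarrow> real \<Rightarrow> real" where
  "p_V V x = inverse (Z_V V) * exp (- V x)"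

definition F_V :: "(real \<Rightarrow> real) \<Rightarrow> real \<Rightarrow> real" where
  "F_V V x = (LBINT t:{..x}. p_V V t)"

definition m_V :: "(real \<Rightarrow> real) \<Rightarrow> real \<Rightarrow> real" where
  "m_V V x = F_V V x / p_V V x"

definition f_V :: "(real \<Rightarrow> real) \<Rightarrow> real \<Rightarrow> real \<Rightarrow> real" where
  "f_V V z x =
     (if x \<le> z then F_V V x * (1 - F_V V z) / p_V V x
      else F_V V z * (1 - F_V V x) / p_V V x)"

text \<open>
  Supremum norms are extended reals, so that an unbounded function has norm \<open>\<infinity>\<close>.
\<close>

definition sup_norm_on :: "real set \<Rightarrow> (real \<Rightarrow> real) \<Rightarrow> ereal" where
  "sup_norm_on S h = (SUP x\<in>S. ereal \<bar>h x\<bar>)"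

abbreviation sup_norm :: "(real \<Rightarrow> real) \<Rightarrow> ereal" where
  "sup_norm h \<equiv> sup_norm_on UNIV h"

text \<open>
  The derivative of \<open>f_V V z\<close> exists only off \<open>z\<close>, where \<^const>\<open>deriv\<close> has an arbitrary value; its
  norm is the supremum over the complement of \<open>z\<close> (which is the essential supremum, because the
  derivative is continuous there).
\<close>

definition norm_f_V' :: "(real \<Rightarrow> real) \<Rightarrow> real \<Rightarrow> ereal" where
  "norm_f_V' V z = sup_norm_on (UNIV - {z}) (deriv (f_V V z))"

definition norm_g_f_V :: "(real \<Rightarrow> real) \<Rightarrow> real \<Rightarrow> ereal" where
  "norm_g_f_V V z = sup_norm (\<lambda>x. deriv V x * f_V V z x)"

definition C_K :: "(real \<Rightarrow> real) \<Rightarrow> ereal" where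
  "C_K V = (SUP z. sup_norm (f_V V z))"

definition B_V :: "(real \<Rightarrow> real) \<Rightarrow> ereal" where
  "B_V V = (INF a\<in>{0<..}. ereal (max (exp (V a) / (4 * p_V V 0)) (1 / deriv V a)))"

definition K_V :: "(real \<Rightarrow> real) \<Rightarrow> real \<Rightarrow> real" where
  "K_V V x = 4 * p_V V 0 * (2 * F_V V x - 1) - deriv V x"

text \<open>
  The derivatives occurring in the statement exist: \<open>F_V V\<close> and \<open>m_V V\<close> are differentiable
  everywhere, and \<open>f_V V z\<close> solves the Stein equation off \<open>z\<close>.
\<close>

lemma V_has_real_derivative:
  assumes "cond_V1 V"
  shows "(V has_real_derivative deriv V x) (at x)"
proof -
  have "(deriv ^^ 0) V differentiable_on UNIV"
    using assms unfolding cond_V1_def C_class_def by (metis zero_less_numeral)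
  then have "V differentiable (at x)"
    by (simp add: differentiable_on_def)
  then show ?thesis
    using DERIV_deriv_iff_real_differentiable by blast
qed

lemma Z_V_pos:
  assumes "cond_V1 V"
  shows "Z_V V > 0"
proof -
  have "integrable lborel (\<lambda>x. exp (- V x))"
    using assms by (simp add: cond_V1_def)
  then have "Z_V V = 0 \<longleftrightarrow> (AE x in lborel. exp (- V x) = 0)"
    unfolding Z_V_def by (intro integral_nonneg_eq_0_iff_AE) auto
  moreover have "\<not> (AE x::real in lborel. False)"
    by (simp add: AE_iff_measurable[of UNIV])
  ultimately have "Z_V V \<noteq> 0"
    by simp
  moreover have "Z_V V \<ge> 0"
    unfolding Z_V_def by simp
  ultimately show ?thesis by simp
qed

lemma p_V_has_real_derivative:
  assumes "cond_V1 V"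
  shows "(p_V V has_real_derivative - deriv V x * p_V V x) (at x)"
  unfolding p_V_def
  by (auto intro!: derivative_eq_intros V_has_real_derivative[OF assms])

lemma p_V_pos:
  assumes "cond_V1 V"
  shows "p_V V x > 0"
  using Z_V_pos[OF assms] by (simp add: p_V_def)

lemma F_V_has_real_derivative:
  assumes "cond_V1 V"
  shows "(F_V V has_real_derivative p_V V x) (at x)"
proof -
  define a where "a = x - 1"
  have cont: "continuous_on S (p_V V)" for S
    by (meson DERIV_isCont continuous_at_imp_continuous_on p_V_has_real_derivative[OF assms])
  have int: "integrable lborel (p_V V)"
    using assms unfolding p_V_def cond_V1_def by simp
  have set_int: "set_integrable lborel A (p_V V)" if "A \<in> sets lborel" for A
    using int that unfolding set_integrable_def
    by (intro integrable_mult_indicator) auto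
  have eq: "F_V V a + integral {a..y} (p_V V) = F_V V y" if "y \<in> {a<..<x + 1}" for y
  proof -
    have "{..y} = {..a} \<union> {a<..y}"
      using that by auto
    then have "F_V V y = F_V V a + (LBINT t:{a<..y}. p_V V t)"
      unfolding F_V_def by (auto intro!: set_integral_Un set_int)
    also have "(LBINT t:{a<..y}. p_V V t) = (LBINT t:{a..y}. p_V V t)"
      unfolding set_lebesgue_integral_def
      by (intro integral_cong_AE)
         (use int AE_lborel_singleton[of a] in \<open>auto simp: indicator_def elim!: eventually_mono\<close>)
    also have "\<dots> = integral {a..y} (p_V V)"
      by (simp add: set_borel_integral_eq_integral(2) set_int)
    finally show ?thesis by simp
  qed
  have "((\<lambda>y. integral {a..y} (p_V V)) has_real_derivative p_V V x) (at x within {a..x + 1})"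
    by (rule integral_has_real_derivative) (auto simp: a_def cont)
  then have "((\<lambda>y. integral {a..y} (p_V V)) has_real_derivative p_V V x) (at x)"
    by (subst (asm) at_within_interior) (auto simp: a_def)
  then have "((\<lambda>y. F_V V a + integral {a..y} (p_V V)) has_real_derivative p_V V x) (at x)"
    by (auto intro!: derivative_eq_intros)
  then show ?thesis
    by (rule has_field_derivative_transform_within_open[where S = "{a<..<x + 1}"])
       (auto simp: a_def eq[unfolded a_def])
qed

lemma m_V_has_real_derivative:
  assumes "cond_V1 V"
  shows "(m_V V has_real_derivative 1 + deriv V x * m_V V x) (at x)"
  unfolding m_V_def using p_V_pos[OF assms, of x]
  by (auto intro!: derivative_eq_intros F_V_has_real_derivative[OF assms]
        p_V_has_real_derivative[OF assms] simp: field_simps)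

lemma f_V_Stein_equation:
  assumes "cond_V1 V" and "x \<noteq> z"
  shows "(f_V V z has_real_derivative
           deriv V x * f_V V z x + indicator {..z} x - F_V V z) (at x)"
proof (cases "x < z")
  case True
  have "((\<lambda>x. F_V V x * (1 - F_V V z) / p_V V x) has_real_derivative
           deriv V x * f_V V z x + indicator {..z} x - F_V V z) (at x)"
    using p_V_pos[OF assms(1), of x] True
    by (auto intro!: derivative_eq_intros F_V_has_real_derivative[OF assms(1)]
          p_V_has_real_derivative[OF assms(1)] simp: field_simps f_V_def)
  then show ?thesis
    by (rule has_field_derivative_transform_within_open[where S = "{..<z}"])
       (use True in \<open>auto simp: f_V_def\<close>)
next
  case False
  then have "z < x"
    using assms(2) by simp
  have "((\<lambda>x. F_V V z * (1 - F_V V x) / p_V V x) has_real_derivative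
           deriv V x * f_V V z x + indicator {..z} x - F_V V z) (at x)"
    using p_V_pos[OF assms(1), of x] \<open>z < x\<close>
    by (auto intro!: derivative_eq_intros F_V_has_real_derivative[OF assms(1)]
          p_V_has_real_derivative[OF assms(1)] simp: field_simps f_V_def)
  then show ?thesis
    by (rule has_field_derivative_transform_within_open[where S = "{z<..}"])
       (use \<open>z < x\<close> in \<open>auto simp: f_V_def\<close>)
qed

end

theory Submission
  imports Defs
begin

text \<open>
  By the symmetry \<open>F (- x) = 1 - F x\<close>, the solution \<open>f z\<close> is \<open>(1 - F z) m x\<close> for \<open>x \<le> z\<close> and
  \<open>F z m (- x)\<close> for \<open>x \<ge> z\<close>, so everything reduces to \<open>m\<close> and \<open>m' = 1 + g m\<close>. Log-concavity of \<open>p\<close>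
  gives \<open>m' \<ge> 0\<close> (part (a)), condition (V3) makes \<open>m'\<close> nondecreasing (part (b)), and
  \<open>inf m' = 0\<close> because \<open>m\<close> is positive, which makes the bounds sharp. Since \<open>m\<close> is nondecreasing,
  \<open>f z\<close> peaks at \<open>z\<close>, and \<open>C_K\<close> is the supremum of \<open>F (1 - F) / p\<close>.
\<close>

section \<open>Comparison from infinity, and suprema reached only by approximation\<close>

text \<open>A function nondecreasing on \<open>{..x}\<close> is at least its limit at minus
  infinity. This replaces integrating the derivative over an unbounded interval.\<close>

lemma nonneg_if_DERIV_nonneg_at_bot:
  fixes f :: "real \<Rightarrow> real"
  assumes "(f \<longlongrightarrow> 0) at_bot"
    and "\<And>t. t \<le> x \<Longrightarrow> \<exists>y. (f has_real_derivative y) (at t) \<and> 0 \<le> y"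
  shows "0 \<le> f x"
proof (rule tendsto_upperbound[OF assms(1)])
  have "f t \<le> f x" if "t \<le> x" for t
    by (rule DERIV_nonneg_imp_nondecreasing[OF that]) (rule assms(2))
  then show "\<forall>\<^sub>F t in at_bot. f t \<le> f x"
    by (auto simp: eventually_at_bot_linorder)
qed simp

lemma nonneg_if_DERIV_nonpos_at_top:
  fixes f :: "real \<Rightarrow> real"
  assumes "(f \<longlongrightarrow> 0) at_top"
    and "\<And>t. x \<le> t \<Longrightarrow> \<exists>y. (f has_real_derivative y) (at t) \<and> y \<le> 0"
  shows "0 \<le> f x"
proof (rule tendsto_upperbound[OF assms(1)])
  have "f t \<le> f x" if "x \<le> t" for t
    by (rule DERIV_nonpos_imp_nonincreasing[OF that]) (rule assms(2))
  then show "\<forall>\<^sub>F t in at_top. f t \<le> f x"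
    by (auto simp: eventually_at_top_linorder)
qed simp

text \<open>Serves the sharpness claims, where the extreme value is approached at infinity or next
  to the excluded point \<open>z\<close>.\<close>

lemma ereal_le_SUP_if_approx:
  fixes h :: "'a \<Rightarrow> ereal"
  assumes "\<And>e. 0 < e \<Longrightarrow> \<exists>x\<in>S. ereal (c - e) \<le> h x"
  shows "ereal c \<le> (SUP x\<in>S. h x)"
proof (rule ereal_le_epsilon2)
  fix e :: real
  assume "0 < e"
  then obtain x where "x \<in> S" "ereal (c - e) \<le> h x"
    using assms by blast
  then have "ereal (c - e) \<le> (SUP x\<in>S. h x)"
    by (meson SUP_upper2)
  then have "ereal (c - e) + ereal e \<le> (SUP x\<in>S. h x) + ereal e"
    by (rule add_right_mono)
  then show "ereal c \<le> (SUP x\<in>S. h x) + ereal e"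
    by simp
qed

lemma sup_norm_on_le:
  assumes "\<And>x. x \<in> S \<Longrightarrow> \<bar>h x\<bar> \<le> c"
  shows "sup_norm_on S h \<le> ereal c"
  unfolding sup_norm_on_def using assms by (intro SUP_least) simp

lemma le_sup_norm_on_if_approx:
  assumes "\<And>e. 0 < e \<Longrightarrow> \<exists>x\<in>S. c - e \<le> \<bar>h x\<bar>"
  shows "ereal c \<le> sup_norm_on S h"
  unfolding sup_norm_on_def using assms by (intro ereal_le_SUP_if_approx) simp

section \<open>Symmetry and monotonicity of \<open>V\<close> and \<open>g\<close>\<close>

locale stein_kernel =
  fixes V :: "real \<Rightarrow> real"
  assumes V1: "cond_V1 V" and V2: "cond_V2 V"
begin

abbreviation "g \<equiv> deriv V"
abbreviation "p \<equiv> p_V V"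
abbreviation "F \<equiv> F_V V"
abbreviation "m \<equiv> m_V V"
abbreviation "f \<equiv> f_V V"
text \<open>The derivative of \<open>m\<close> in closed form, so that bounds on it are bounds on
  \<open>g m\<close>.\<close>

abbreviation "dm x \<equiv> 1 + g x * m x"

lemma p_pos: "p x > 0"
  using p_V_pos[OF V1] .

lemma g_DERIV: "(g has_real_derivative deriv g x) (at x)"
proof -
  have "\<forall>i<2. (deriv ^^ i) V differentiable_on UNIV"
    using V1 by (simp add: cond_V1_def C_class_def)
  from this[rule_format, of 1] have "g differentiable_on UNIV"
    by simp
  then show ?thesis
    by (simp add: differentiable_on_def DERIV_deriv_iff_real_differentiable)
qed

lemma deriv_g_DERIV:
  assumes "x \<noteq> 0"
  shows "(deriv g has_real_derivative deriv (deriv g) x) (at x)"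
proof -
  have "\<forall>i<3. (deriv ^^ i) V differentiable_on UNIV - {0}"
    using V1 by (simp add: cond_V1_def C_class_def)
  from this[rule_format, of 2] have "deriv g differentiable_on UNIV - {0}"
    by (simp add: numeral_2_eq_2)
  then have "deriv g differentiable at x within UNIV - {0}"
    using assms by (simp add: differentiable_on_def)
  then have "deriv g differentiable at x"
    using assms by (simp add: at_within_open[of x "UNIV - {0}"] open_delete)
  then show ?thesis
    by (simp add: DERIV_deriv_iff_real_differentiable)
qed

lemma g_minus: "g (- x) = - g x"
proof -
  have "((\<lambda>x. V (- x)) has_real_derivative g (- x) * (- 1)) (at x)"
    by (rule DERIV_chain2[OF V_has_real_derivative[OF V1]]) (auto intro!: derivative_eq_intros)
  moreover have "(\<lambda>x. V (- x)) = V"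
    using V1 by (auto simp: cond_V1_def)
  ultimately have "(V has_real_derivative - g (- x)) (at x)"
    by simp
  then show ?thesis
    using DERIV_unique V_has_real_derivative[OF V1] by (metis minus_minus)
qed

lemma g_0: "g 0 = 0"
  using g_minus[of 0] by simp

lemma g_mono: "x \<le> y \<Longrightarrow> g x \<le> g y"
  using V2 g_DERIV unfolding cond_V2_def by (metis DERIV_nonneg_imp_nondecreasing)

lemma g_pos: "0 < x \<Longrightarrow> 0 < g x"
  using V2 by (auto simp: cond_V2_def)

lemma g_nonneg: "0 \<le> x \<Longrightarrow> 0 \<le> g x"
  using g_mono[of 0 x] g_0 by simp

lemma g_neg: "x < 0 \<Longrightarrow> g x < 0"
  using g_pos[of "- x"] g_minus[of x] by simp

lemma V_mono:
  assumes "0 \<le> x" "x \<le> y"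
  shows "V x \<le> V y"
proof (rule DERIV_nonneg_imp_nondecreasing[OF assms(2)])
  fix t
  assume "x \<le> t"
  then have "0 \<le> g t"
    using assms(1) g_nonneg by simp
  then show "\<exists>y. (V has_real_derivative y) (at t) \<and> 0 \<le> y"
    using V_has_real_derivative[OF V1] by blast
qed

section \<open>The density \<open>p\<close> and the distribution function \<open>F\<close>\<close>

lemma p_minus: "p (- x) = p x"
  using V1 by (simp add: p_V_def cond_V1_def)

lemma p_eq: "p x = p 0 * exp (- V x)"
  using V1 by (simp add: p_V_def cond_V1_def)

lemma p_DERIV: "(p has_real_derivative - g x * p x) (at x)"
  using p_V_has_real_derivative[OF V1] .

lemma F_DERIV: "(F has_real_derivative p x) (at x)"
  using F_V_has_real_derivative[OF V1] .

lemma m_DERIV: "(m has_real_derivative dm x) (at x)"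
  using m_V_has_real_derivative[OF V1] .

lemma deriv_m: "deriv m x = dm x"
  using m_DERIV DERIV_imp_deriv by blast

lemma p_integrable: "integrable lborel p"
  using V1 unfolding p_V_def cond_V1_def by simp

lemma p_integral: "(\<integral>x. p x \<partial>lborel) = 1"
  using Z_V_pos[OF V1] unfolding p_V_def by (simp flip: Z_V_def)

lemma F_eq: "F x = (\<integral>t. indicator {..x} t * p t \<partial>lborel)"
  by (simp add: F_V_def set_lebesgue_integral_def)

text \<open>Substituting \<open>- t\<close> for \<open>t\<close> turns the left tail at
  \<open>- x\<close> into the right tail at \<open>x\<close>; the two tails at \<open>x\<close>
  overlap only in the null set \<open>{x}\<close>.\<close>

lemma F_minus: "F (- x) = 1 - F x"
proof -
  have int: "integrable lborel (\<lambda>t. indicator A t * p t)" if "A \<in> sets lborel" for A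
    using integrable_mult_indicator[OF that p_integrable] by simp
  have "F (- x) = (\<integral>t. indicator {..- x} (- t) * p (- t) \<partial>lborel)"
    unfolding F_eq using lborel_integral_real_affine[of "- 1" "\<lambda>t. indicator {..- x} t * p t" 0]
    by simp
  also have "\<dots> = (\<integral>t. indicator {x..} t * p t \<partial>lborel)"
    by (intro Bochner_Integration.integral_cong) (auto simp: p_minus indicator_def)
  finally have "F x + F (- x) = (\<integral>t. indicator {..x} t * p t + indicator {x..} t * p t \<partial>lborel)"
    unfolding F_eq using int[of "{..x}"] int[of "{x..}"] by simp
  also have "\<dots> = (\<integral>t. p t \<partial>lborel)"
    using p_integrable AE_lborel_singleton[of x]
    by (intro integral_cong_AE) (auto simp: indicator_def elim!: eventually_mono)
  finally show ?thesis
    by (simp add: p_integral)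
qed

lemma F_0: "F 0 = 1 / 2"
  using F_minus[of 0] by simp

lemma F_at_top: "(F \<longlongrightarrow> 1) at_top"
  using tendsto_integral_at_top[OF _ p_integrable] unfolding F_eq by (simp add: p_integral)

lemma F_at_bot: "(F \<longlongrightarrow> 0) at_bot"
proof -
  have "((\<lambda>x. 1 - F x) \<longlongrightarrow> 1 - 1) at_top"
    by (intro tendsto_intros F_at_top)
  then show ?thesis
    by (simp add: filterlim_at_bot_mirror F_minus)
qed

lemma F_less: "x < y \<Longrightarrow> F x < F y"
  using F_DERIV p_pos by (metis DERIV_pos_imp_increasing)

lemma F_mono: "x \<le> y \<Longrightarrow> F x \<le> F y"
  using F_less by (cases "x = y") (auto simp: less_imp_le)

lemma F_pos: "F x > 0"
  using DERIV_pos_imp_increasing_at_bot[OF _ F_at_bot] F_DERIV p_pos by blast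

lemma F_less_1: "F x < 1"
  using F_pos[of "- x"] by (simp add: F_minus)

text \<open>On the negative half-line \<open>p\<close> is nondecreasing, so \<open>p x\<close> is at
  most its mean over the unit interval to the right of \<open>x\<close>, hence at most
  \<open>F (x + 1)\<close>.\<close>

lemma p_at_bot: "(p \<longlongrightarrow> 0) at_bot"
proof (rule tendsto_sandwich[OF _ _ tendsto_const F_at_bot[THEN filterlim_compose]])
  show "filterlim (\<lambda>x. x + 1 :: real) at_bot at_bot"
    unfolding filterlim_at_bot eventually_at_bot_linorder by (meson le_diff_eq)
  show "\<forall>\<^sub>F x in at_bot. 0 \<le> p x"
    using p_pos less_imp_le by (auto intro!: always_eventually)
  \<comment> \<open>\<open>x \<le> - 1\<close> keeps the whole interval up to \<open>x + 1\<close>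
    where \<open>g \<le> 0\<close>.\<close>
  have "p x \<le> F (x + 1)" if x: "x \<le> - 1" for x
  proof -
    obtain t where t: "x < t" "t < x + 1" "F (x + 1) - F x = (x + 1 - x) * p t"
      using MVT2[of x "x + 1" F p] F_DERIV by auto
    have "p x \<le> p t"
    proof (rule DERIV_nonneg_imp_nondecreasing[where f = p])
      fix s
      assume "x \<le> s" "s \<le> t"
      then have "g s \<le> 0"
        using t(2) x g_mono[of s 0] g_0 by simp
      then have "0 \<le> - g s * p s"
        using p_pos[of s] by (simp add: mult_nonpos_nonneg)
      then show "\<exists>y. (p has_real_derivative y) (at s) \<and> 0 \<le> y"
        using p_DERIV by blast
    qed (use t in simp)
    then show ?thesis
      using t(3) F_pos[of x] by simp
  qed
  then show "\<forall>\<^sub>F x in at_bot. p x \<le> F (x + 1)"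
    by (auto simp: eventually_at_bot_linorder)
qed

section \<open>The ratio \<open>m\<close> and its derivative\<close>

lemma m_pos: "m x > 0"
  using F_pos p_pos by (simp add: m_V_def)

text \<open>The Mills ratio bound; it compares \<open>F\<close> with \<open>p / (- g x)\<close> on \<open>{..x}\<close> for \<open>x < 0\<close>.\<close>

lemma dm_nonneg: "0 \<le> dm x"
proof (cases "0 \<le> x")
  case True
  then show ?thesis
    using g_nonneg[of x] m_pos[of x] by simp
next
  case False
  have "0 \<le> p x + g x * F x"
  proof (rule nonneg_if_DERIV_nonneg_at_bot[where f = "\<lambda>t. p t + g x * F t"])
    have "((\<lambda>t. p t + g x * F t) \<longlongrightarrow> 0 + g x * 0) at_bot"
      by (intro tendsto_intros p_at_bot F_at_bot)
    then show "((\<lambda>t. p t + g x * F t) \<longlongrightarrow> 0) at_bot"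
      by simp
    fix t
    assume "t \<le> x"
    then have "0 \<le> (g x - g t) * p t"
      using g_mono p_pos[of t] by simp
    moreover have "((\<lambda>t. p t + g x * F t) has_real_derivative (g x - g t) * p t) (at t)"
      by (auto intro!: derivative_eq_intros p_DERIV F_DERIV simp: algebra_simps)
    ultimately show "\<exists>y. ((\<lambda>t. p t + g x * F t) has_real_derivative y) (at t) \<and> 0 \<le> y"
      by blast
  qed
  then show ?thesis
    using p_pos[of x] by (simp add: m_V_def field_simps)
qed

lemma m_mono: "x \<le> y \<Longrightarrow> m x \<le> m y"
  using m_DERIV dm_nonneg by (metis DERIV_nonneg_imp_nondecreasing)

text \<open>If \<open>dm \<ge> e\<close> everywhere, \<open>m\<close> would become negative at \<open>- \<infinity>\<close>.\<close>

lemma dm_small: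
  assumes "0 < e"
  shows "\<exists>x\<le>a. dm x < e"
proof (rule ccontr)
  assume "\<not> ?thesis"
  then have ge: "e \<le> dm x" if "x \<le> a" for x
    using that by (auto simp: not_less)
  \<comment> \<open>The line of slope \<open>e\<close> through \<open>(a, m a)\<close> vanishes at
    \<open>b\<close>; a derivative of at least \<open>e\<close> would put \<open>m b\<close> on or
    below it.\<close>
  define b where "b = a - m a / e"
  have "b < a"
    using m_pos[of a] assms by (simp add: b_def)
  then obtain t where t: "b < t" "t < a" "m a - m b = (a - b) * dm t"
    using MVT2[of b a m dm] m_DERIV by auto
  have "m a = (a - b) * e"
    using assms by (simp add: b_def)
  also have "\<dots> \<le> (a - b) * dm t"
    using ge[of t] t(2) \<open>b < a\<close> by (intro mult_left_mono) auto
  finally show False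
    using t(3) m_pos[of b] by simp
qed

section \<open>Reflection and the norm of \<open>g f\<close>\<close>

lemma f_le: "x \<le> z \<Longrightarrow> f z x = (1 - F z) * m x"
  by (simp add: f_V_def m_V_def)

lemma f_ge:
  assumes "z \<le> x"
  shows "f z x = F z * m (- x)"
  \<comment> \<open>At \<open>x = z\<close> the definition takes its left branch, which agrees with
    the right one.\<close>
  using assms by (cases "x = z") (auto simp: f_V_def m_V_def F_minus p_minus)

text \<open>With \<open>g\<close> odd, this carries an estimate on one side of \<open>z\<close> to
  the other side for \<open>- z\<close>, exchanging \<open>F z\<close> and
  \<open>1 - F z\<close>.\<close>

lemma f_reflect: "f z x = f (- z) (- x)"
  by (cases "x \<le> z") (auto simp: f_le f_ge F_minus)

lemma g_f_le: "g x * f z x \<le> F z"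
proof (cases "x \<le> z")
  case True
  show ?thesis
  proof (cases "0 \<le> x")
    case nonneg: True
    \<comment> \<open>Once \<open>1 - F z\<close> is enlarged to \<open>1 - F x\<close>, evenness of
      \<open>p\<close> gives \<open>(1 - F x) * m x = F x * m (- x)\<close>, so that
      \<open>dm (- x) \<ge> 0\<close> applies.\<close>
    have "g x * f z x \<le> g x * (1 - F x) * m x"
      using True nonneg F_mono[OF True] g_nonneg[OF nonneg] m_pos[of x]
      by (simp add: f_le mult.assoc mult_left_mono mult_right_mono)
    also have "\<dots> = F x * (g x * m (- x))"
      by (simp add: m_V_def F_minus p_minus)
    also have "\<dots> \<le> F x * 1"
      using dm_nonneg[of "- x"] F_pos[of x] by (intro mult_left_mono) (auto simp: g_minus)
    also have "\<dots> \<le> F z"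
      using F_mono[OF True] by simp
    finally show ?thesis .
  next
    case False
    then have "g x * f z x \<le> 0"
      using True g_neg[of x] m_pos[of x] F_less_1[of z] by (simp add: f_le mult_nonpos_nonneg)
    then show ?thesis
      using F_pos[of z] by simp
  qed
next
  case False
  then have "g x * f z x = F z * (1 - dm (- x))"
    by (simp add: f_ge g_minus)
  also have "\<dots> \<le> F z * 1"
    using F_pos[of z] dm_nonneg[of "- x"] by (intro mult_left_mono) auto
  finally show ?thesis
    by simp
qed

lemma g_f_ge: "- (1 - F z) \<le> g x * f z x"
  using g_f_le[of "- x" "- z"] by (simp add: g_minus F_minus flip: f_reflect)

text \<open>For \<open>x \<le> z\<close> the function is \<open>(1 - F z) * (dm x - 1)\<close>, and
  \<open>dm\<close> takes arbitrarily small values there. Reflection gives the other lower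
  bound.\<close>

lemma norm_g_f_eq: "norm_g_f_V V z = ereal (max (F z) (1 - F z))"
proof (rule antisym)
  have "\<bar>g x * f z x\<bar> \<le> max (F z) (1 - F z)" for x
    using g_f_le[of x z] g_f_ge[of z x] by linarith
  then show "norm_g_f_V V z \<le> ereal (max (F z) (1 - F z))"
    unfolding norm_g_f_V_def by (rule sup_norm_on_le)
  have lower: "ereal (1 - F z) \<le> norm_g_f_V V z" for z
    unfolding norm_g_f_V_def
  proof (rule le_sup_norm_on_if_approx)
    fix e :: real
    assume "0 < e"
    then obtain x where x: "x \<le> z" "dm x < e"
      using dm_small by blast
    have "(1 - F z) * dm x \<le> 1 * e"
      using x F_pos[of z] F_less_1[of z] dm_nonneg[of x] by (intro mult_mono) auto
    moreover have "g x * f z x = (1 - F z) * dm x - (1 - F z)"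
      using x by (simp add: f_le algebra_simps)
    ultimately have "1 - F z - e \<le> \<bar>g x * f z x\<bar>"
      by linarith
    then show "\<exists>x\<in>UNIV. 1 - F z - e \<le> \<bar>g x * f z x\<bar>"
      by blast
  qed
  have "norm_g_f_V V (- z) \<le> norm_g_f_V V z"
    unfolding norm_g_f_V_def sup_norm_on_def
    by (rule SUP_least, rule SUP_upper2[where i = "- x" for x])
       (auto simp: g_minus f_reflect[of "- z"])
  then show "ereal (max (F z) (1 - F z)) \<le> norm_g_f_V V z"
    using lower[of z] lower[of "- z"] by (auto simp: F_minus max_def)
qed

section \<open>The derivative of \<open>f z\<close>\<close>

lemma deriv_f_less: "x < z \<Longrightarrow> deriv (f z) x = (1 - F z) * dm x"
  using f_V_Stein_equation[OF V1, of x z, THEN DERIV_imp_deriv] by (simp add: f_le algebra_simps)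

lemma deriv_f_greater: "z < x \<Longrightarrow> deriv (f z) x = - F z * dm (- x)"
  using f_V_Stein_equation[OF V1, of x z, THEN DERIV_imp_deriv]
  by (simp add: f_ge g_minus algebra_simps)

text \<open>The sign of the derivative on each side of \<open>z\<close> comes from
  \<open>dm \<ge> 0\<close>; the remaining bound comes from the Stein equation and the bounds on
  \<open>g f\<close>.\<close>

lemma norm_f'_le_1: "norm_f_V' V z \<le> 1"
proof -
  have "\<bar>deriv (f z) x\<bar> \<le> 1" if "x \<noteq> z" for x
  proof -
    have "deriv (f z) x = g x * f z x + indicator {..z} x - F z"
      using f_V_Stein_equation[OF V1 that] by (rule DERIV_imp_deriv)
    moreover have "x < z \<Longrightarrow> 0 \<le> deriv (f z) x" "z < x \<Longrightarrow> deriv (f z) x \<le> 0"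
      using F_pos[of z] F_less_1[of z] dm_nonneg[of x] dm_nonneg[of "- x"]
      by (auto simp: deriv_f_less deriv_f_greater mult_nonneg_nonneg)
    ultimately show ?thesis
      using that g_f_le[of x z] g_f_ge[of z x] by (cases "x < z") auto
  qed
  then show ?thesis
    unfolding norm_f_V'_def one_ereal_def by (intro sup_norm_on_le) auto
qed

section \<open>The peak of \<open>f z\<close> and bounds on \<open>C_K\<close>\<close>

lemma sup_norm_f: "sup_norm (f z) = ereal (F z * F (- z) / p z)"
proof (rule antisym)
  have peak: "f z z = F z * F (- z) / p z"
    by (simp add: f_V_def F_minus)
  have "\<bar>f z x\<bar> \<le> f z z" for x
  proof (cases "x \<le> z")
    case True
    then show ?thesis
      using m_mono[OF True] m_pos[of x] F_less_1[of z] by (simp add: f_le abs_mult)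
  next
    case False
    then show ?thesis
      using m_mono[of "- x" "- z"] m_pos[of "- x"] F_pos[of z] by (simp add: f_ge abs_mult)
  qed
  then show "sup_norm (f z) \<le> ereal (F z * F (- z) / p z)"
    unfolding peak by (intro sup_norm_on_le)
  have "ereal \<bar>f z z\<bar> \<le> sup_norm (f z)"
    unfolding sup_norm_on_def by (rule SUP_upper) simp
  then show "ereal (F z * F (- z) / p z) \<le> sup_norm (f z)"
    using F_pos[of z] F_pos[of "- z"] p_pos[of z] unfolding peak by simp
qed

text \<open>The peak value is even in \<open>z\<close>, so nonnegative \<open>z\<close>
  suffice.\<close>

lemma C_K_le:
  assumes "\<And>z. 0 \<le> z \<Longrightarrow> F z * F (- z) / p z \<le> c"
  shows "C_K V \<le> ereal c"
proof -
  have "F z * F (- z) / p z \<le> c" for z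
    using assms[of z] assms[of "- z"] by (cases "0 \<le> z") (auto simp: p_minus mult.commute)
  then show ?thesis
    unfolding C_K_def sup_norm_f by (intro SUP_least) simp
qed

lemma C_K_lower: "ereal (1 / (4 * p 0)) \<le> C_K V"
proof -
  have "sup_norm (f 0) \<le> C_K V"
    unfolding C_K_def by (rule SUP_upper) simp
  then show ?thesis
    by (simp add: sup_norm_f F_0)
qed

text \<open>The point \<open>a\<close> splits the peaks: up to \<open>a\<close>,
  \<open>F (1 - F) \<le> 1/4\<close> and \<open>p\<close> is at least \<open>p a\<close>; beyond
  \<open>a\<close>, the peak is at most \<open>m (- z)\<close>, which
  \<open>dm (- z) \<ge> 0\<close> bounds by \<open>1 / g z\<close>.\<close>

lemma C_K_upper:
  assumes a: "0 < a"
  shows "C_K V \<le> ereal (max (exp (V a) / (4 * p 0)) (1 / g a))"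
proof (rule C_K_le)
  fix z :: real
  assume z: "0 \<le> z"
  show "F z * F (- z) / p z \<le> max (exp (V a) / (4 * p 0)) (1 / g a)"
  proof (cases "z \<le> a")
    case True
    have "F z * F (- z) = 1 / 4 - (F z - 1 / 2)\<^sup>2"
      by (simp add: F_minus power2_eq_square algebra_simps)
    then have "F z * F (- z) \<le> 1 / 4"
      by simp
    then have "F z * F (- z) / p z \<le> 1 / 4 / p z"
      using p_pos[of z] by (intro divide_right_mono) auto
    also have "1 / 4 / p z = exp (V z) / (4 * p 0)"
      by (subst p_eq) (simp add: exp_minus field_simps)
    also have "\<dots> \<le> exp (V a) / (4 * p 0)"
      using V_mono[OF z True] p_pos[of 0] by (intro divide_right_mono) auto
    finally show ?thesis
      by simp
  next
    case False
    have "F z * F (- z) / p z = F z * m (- z)"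
      by (simp add: m_V_def p_minus)
    also have "\<dots> \<le> m (- z)"
      using F_less_1[of z] m_pos[of "- z"] by simp
    also have "\<dots> \<le> 1 / g z"
      using dm_nonneg[of "- z"] g_pos[of z] a False by (simp add: g_minus field_simps)
    also have "\<dots> \<le> 1 / g a"
      using g_pos[OF a] g_mono[of a z] False by (intro divide_left_mono) auto
    finally show ?thesis
      by simp
  qed
qed

lemma C_K_le_B: "C_K V \<le> B_V V"
  unfolding B_V_def using C_K_upper by (intro INF_greatest) auto

lemma B_finite: "B_V V < \<infinity>"
proof -
  have "B_V V \<le> ereal (max (exp (V 1) / (4 * p 0)) (1 / g 1))"
    unfolding B_V_def by (rule INF_lower) simp
  also have "\<dots> < \<infinity>"
    by (simp add: max_def)
  finally show ?thesis .
qed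

section \<open>Monotonicity under (V3) and exact norms\<close>

text \<open>
  Since \<open>(g m)' = g' m + g (1 + g m)\<close>, monotonicity of \<open>g m\<close> on the negative half-line says that
  \<open>F + g p / (g' + g\<^sup>2)\<close> is nonnegative there. This function vanishes at \<open>- \<infinity>\<close>, and its derivative
  is \<open>p (2 g'\<^sup>2 - g g'') / (g' + g\<^sup>2)\<^sup>2\<close>.
\<close>

lemma F_lower_if_V3:
  assumes V3: "cond_V3 V" and x: "x < 0"
  shows "0 \<le> F x + g x * p x / (deriv g x + (g x)\<^sup>2)"
proof (rule nonneg_if_DERIV_nonneg_at_bot[where f = "\<lambda>t. F t + g t * p t / (deriv g t + (g t)\<^sup>2)"])
  have g': "0 \<le> deriv g t" for t
    using V2 by (simp add: cond_V2_def)
  have q: "0 < deriv g t + (g t)\<^sup>2" if "t < 0" for t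
    using g'[of t] g_neg[OF that] by (simp add: add_nonneg_pos)
  \<comment> \<open>Dropping \<open>g' \<ge> 0\<close> from the denominator leaves
    \<open>p t / - g t\<close>, and \<open>- g t \<ge> - g x\<close> since \<open>g\<close> is
    nondecreasing.\<close>
  have bound: "\<bar>g t * p t / (deriv g t + (g t)\<^sup>2)\<bar> \<le> p t / - g x" if "t \<le> x" for t
  proof -
    have neg: "t < 0" "g t < 0" "g x < 0" "g t \<le> g x"
      using that x g_neg g_mono by auto
    have "\<bar>g t * p t / (deriv g t + (g t)\<^sup>2)\<bar> = - g t * p t / (deriv g t + (g t)\<^sup>2)"
      using neg q[of t] p_pos[of t] by (simp add: abs_mult)
    also have "\<dots> \<le> - g t * p t / (g t)\<^sup>2"
      using neg g'[of t] p_pos[of t] q[of t]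
      by (intro divide_left_mono) (auto simp: mult_nonpos_nonneg)
    also have "\<dots> = p t / - g t"
      using neg by (simp add: power2_eq_square)
    also have "\<dots> \<le> p t / - g x"
      using neg p_pos[of t] by (intro divide_left_mono) (auto simp: mult_neg_neg)
    finally show ?thesis .
  qed
  have "((\<lambda>t. g t * p t / (deriv g t + (g t)\<^sup>2)) \<longlongrightarrow> 0) at_bot"
  proof (rule tendsto_0_le[where K = 1])
    show "((\<lambda>t. p t / - g x) \<longlongrightarrow> 0) at_bot"
      using tendsto_divide[OF p_at_bot tendsto_const[of "- g x"]] g_neg[OF x] by simp
    have "norm (g t * p t / (deriv g t + (g t)\<^sup>2)) \<le> norm (p t / - g x) * 1" if "t \<le> x" for t
      using order_trans[OF bound[OF that] abs_ge_self] by (simp only: real_norm_def mult_1_right)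
    then show "\<forall>\<^sub>F t in at_bot. norm (g t * p t / (deriv g t + (g t)\<^sup>2)) \<le> norm (p t / - g x) * 1"
      unfolding eventually_at_bot_linorder by blast
  qed
  then show "((\<lambda>t. F t + g t * p t / (deriv g t + (g t)\<^sup>2)) \<longlongrightarrow> 0) at_bot"
    using tendsto_add[OF F_at_bot] by fastforce
  fix t
  assume "t \<le> x"
  then have t: "t < 0"
    using x by simp
  let ?q = "deriv g t + (g t)\<^sup>2"
  have "((\<lambda>t. F t + g t * p t / (deriv g t + (g t)\<^sup>2)) has_real_derivative
      p t + ((deriv g t * p t + - g t * p t * g t) * ?q
        - g t * p t * (deriv (deriv g) t + 2 * g t * deriv g t)) / (?q * ?q)) (at t)"
    using t q[OF t]
    by (auto intro!: derivative_eq_intros p_DERIV F_DERIV g_DERIV deriv_g_DERIV simp: algebra_simps)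
  moreover have "p t + ((deriv g t * p t + - g t * p t * g t) * ?q
        - g t * p t * (deriv (deriv g) t + 2 * g t * deriv g t)) / (?q * ?q)
      = p t * (2 * (deriv g t)\<^sup>2 - g t * deriv (deriv g) t) / (?q * ?q)"
  proof -
    have nz: "?q * ?q \<noteq> 0"
      using q[OF t] by simp
    show ?thesis
      unfolding add_divide_eq_iff[OF nz]
      by (rule arg_cong[where f = "\<lambda>u. u / (?q * ?q)"]) (simp add: algebra_simps power2_eq_square)
  qed
  moreover have "0 \<le> p t * (2 * (deriv g t)\<^sup>2 - g t * deriv (deriv g) t) / (?q * ?q)"
    using V3 t p_pos[of t] by (auto simp: cond_V3_def intro!: divide_nonneg_nonneg mult_nonneg_nonneg)
  ultimately show "\<exists>y. ((\<lambda>t. F t + g t * p t / (deriv g t + (g t)\<^sup>2)) has_real_derivative y) (at t)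
      \<and> 0 \<le> y"
    by (intro exI conjI) (assumption, simp only:)
qed

text \<open>The derivative \<open>g' m + g dm\<close> has only nonnegative factors for
  \<open>t \<ge> 0\<close>. For \<open>t < 0\<close> it is the expression of
  \<open>F_lower_if_V3\<close> times the positive factor \<open>(g' + g^2) / p\<close>.\<close>

lemma dm_mono_if_V3:
  assumes V3: "cond_V3 V" and "x \<le> y"
  shows "dm x \<le> dm y"
proof (rule DERIV_nonneg_imp_nondecreasing[OF \<open>x \<le> y\<close>])
  fix t
  have g': "0 \<le> deriv g t"
    using V2 by (simp add: cond_V2_def)
  have "0 \<le> deriv g t * m t + g t * dm t"
  proof (cases "0 \<le> t")
    case True
    then show ?thesis
      using g' m_pos[of t] g_nonneg[of t] dm_nonneg[of t]
      by (intro add_nonneg_nonneg mult_nonneg_nonneg) auto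
  next
    case False
    then have "g t < 0"
      using g_neg by simp
    then have q: "0 < deriv g t + (g t)\<^sup>2"
      using g' by (simp add: add_nonneg_pos)
    have "0 \<le> (F t + g t * p t / (deriv g t + (g t)\<^sup>2)) * ((deriv g t + (g t)\<^sup>2) / p t)"
      using F_lower_if_V3[OF V3, of t] False q p_pos[of t] by (intro mult_nonneg_nonneg) auto
    also have "\<dots> = F t / p t * (deriv g t + (g t)\<^sup>2) + g t"
      using q p_pos[of t] by (subst distrib_right) simp
    also have "\<dots> = deriv g t * m t + g t * dm t"
      by (simp add: m_V_def algebra_simps power2_eq_square)
    finally show ?thesis .
  qed
  moreover have "(dm has_real_derivative deriv g t * m t + g t * dm t) (at t)"
    by (auto intro!: derivative_eq_intros g_DERIV m_DERIV simp: algebra_simps)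
  ultimately show "\<exists>y. (dm has_real_derivative y) (at t) \<and> 0 \<le> y"
    by blast
qed

lemma g_f_mono_if_V3:
  assumes "cond_V3 V"
  shows "mono (\<lambda>x. g x * f z x)"
proof -
  have left: "g x * f z x \<le> g y * f z y" if "x \<le> y" "y \<le> z" for x y z
    using that dm_mono_if_V3[OF assms that(1)] F_less_1[of z] by (simp add: f_le mult.left_commute)
  have right: "g x * f z x \<le> g y * f z y" if "x \<le> y" "z \<le> x" for x y
    using left[of "- y" "- x" "- z"] that by (simp add: g_minus flip: f_reflect)
  show ?thesis
  proof (rule monoI)
    fix x y :: real
    \<comment> \<open>If \<open>z\<close> lies between \<open>x\<close> and \<open>y\<close>, the
      two one-sided inequalities are chained through the value at \<open>z\<close>.\<close>
    assume "x \<le> y"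
    then show "g x * f z x \<le> g y * f z y"
      using left[of x y z] right[of x y] left[of x z z] right[of z y]
      by (meson linear order_trans order_refl)
  qed
qed

text \<open>Since \<open>dm\<close> is nondecreasing, the absolute derivative grows towards
  \<open>z\<close> from both sides; its one-sided limits at \<open>z\<close> are the two terms of
  the maximum.\<close>

lemma norm_f'_eq_if_V3:
  assumes V3: "cond_V3 V"
  shows "norm_f_V' V z = ereal (max ((1 - F z) * dm z) (F z * dm (- z)))"
proof (rule antisym)
  show "norm_f_V' V z \<le> ereal (max ((1 - F z) * dm z) (F z * dm (- z)))"
    unfolding norm_f_V'_def
  proof (rule sup_norm_on_le)
    fix x
    assume "x \<in> UNIV - {z}"
    then consider "x < z" | "z < x"
      by fastforce
    then show "\<bar>deriv (f z) x\<bar> \<le> max ((1 - F z) * dm z) (F z * dm (- z))"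
    proof cases
      case 1
      then have "(1 - F z) * dm x \<le> (1 - F z) * dm z"
        using dm_mono_if_V3[OF V3, of x z] F_less_1[of z] by (intro mult_left_mono) auto
      then show ?thesis
        using 1 F_less_1[of z] dm_nonneg[of x]
        by (simp add: deriv_f_less abs_mult le_max_iff_disj)
    next
      case 2
      then have "F z * dm (- x) \<le> F z * dm (- z)"
        using dm_mono_if_V3[OF V3, of "- x" "- z"] F_pos[of z] by (intro mult_left_mono) auto
      then show ?thesis
        using 2 F_pos[of z] dm_nonneg[of "- x"]
        by (simp add: deriv_f_greater abs_mult le_max_iff_disj)
    qed
  qed
  \<comment> \<open>The norm omits \<open>z\<close>, so the values at \<open>z\<close> are
    approached through continuity of \<open>dm\<close>; the right side uses this at
    \<open>- z\<close>.\<close>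
  have approx: "\<exists>x<z. dm z - e < dm x" if "0 < e" for e z
  proof -
    have "isCont dm z"
      by (intro continuous_intros DERIV_isCont[OF g_DERIV] DERIV_isCont[OF m_DERIV])
    then have "(dm \<longlongrightarrow> dm z) (at_left z)"
      unfolding isCont_def using filterlim_at_split by blast
    then have "\<forall>\<^sub>F x in at_left z. dm z - e < dm x"
      using that by (intro order_tendstoD(1)) auto
    then obtain b where "b < z" "\<And>y. b < y \<Longrightarrow> y < z \<Longrightarrow> dm z - e < dm y"
      by (auto simp: eventually_at_left_field)
    then show ?thesis
      using dense by blast
  qed
  have scaled: "c * a - e \<le> c * b" if "0 < c" "c < 1" "0 < e" "a - e < b" for a b c e :: real
  proof -
    have "c * (a - e) \<le> c * b"
      using that by (intro mult_left_mono) auto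
    moreover have "c * e \<le> e"
      using that by simp
    ultimately show ?thesis
      by (simp add: right_diff_distrib)
  qed
  have "ereal ((1 - F z) * dm z) \<le> norm_f_V' V z"
    unfolding norm_f_V'_def
  proof (rule le_sup_norm_on_if_approx)
    fix e :: real
    assume "0 < e"
    then obtain x where x: "x < z" "dm z - e < dm x"
      using approx by blast
    have "(1 - F z) * dm z - e \<le> \<bar>deriv (f z) x\<bar>"
      using scaled[of "1 - F z" e "dm z" "dm x"] x \<open>0 < e\<close> F_pos[of z] F_less_1[of z] dm_nonneg[of x]
      by (simp add: deriv_f_less abs_mult)
    then show "\<exists>x\<in>UNIV - {z}. (1 - F z) * dm z - e \<le> \<bar>deriv (f z) x\<bar>"
      using x(1) by blast
  qed
  moreover have "ereal (F z * dm (- z)) \<le> norm_f_V' V z"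
    unfolding norm_f_V'_def
  proof (rule le_sup_norm_on_if_approx)
    fix e :: real
    assume "0 < e"
    then obtain x where x: "x < - z" "dm (- z) - e < dm x"
      using approx by blast
    have "F z * dm (- z) - e \<le> \<bar>deriv (f z) (- x)\<bar>"
      using scaled[of "F z" e "dm (- z)" "dm x"] x \<open>0 < e\<close> F_pos[of z] F_less_1[of z] dm_nonneg[of x]
      by (simp add: deriv_f_greater abs_mult)
    then show "\<exists>x\<in>UNIV - {z}. F z * dm (- z) - e \<le> \<bar>deriv (f z) x\<bar>"
      using x(1) by (intro bexI[of _ "- x"]) auto
  qed
  ultimately show "ereal (max ((1 - F z) * dm z) (F z * dm (- z))) \<le> norm_f_V' V z"
    by (auto simp: max_def)
qed

lemma SUP_norm_f'_if_V3:
  assumes V3: "cond_V3 V"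
  shows "(SUP z. norm_f_V' V z) = 1"
proof (rule antisym)
  show "(SUP z. norm_f_V' V z) \<le> 1"
    by (rule SUP_least) (rule norm_f'_le_1)
  show "1 \<le> (SUP z. norm_f_V' V z)"
    unfolding one_ereal_def
  proof (rule ereal_le_SUP_if_approx)
    fix e :: real
    assume "0 < e"
    then obtain z where z: "dm z < e"
      using dm_small by blast
    \<comment> \<open>This identity leads to \<open>F z * dm (- z) = 1 - F (- z) * dm z\<close>, so
      a small \<open>dm z\<close> brings the second term of the maximum near 1.\<close>
    have "F z * m (- z) = F (- z) * m z"
      by (simp add: m_V_def p_minus)
    then have "F z * dm (- z) = F z - g z * (F (- z) * m z)"
      by (simp add: g_minus algebra_simps)
    also have "\<dots> = 1 - F (- z) * dm z"
      by (simp add: F_minus algebra_simps)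
    also have "\<dots> \<ge> 1 - 1 * e"
      using z F_pos[of "- z"] F_less_1[of "- z"] dm_nonneg[of z]
      by (intro diff_left_mono mult_mono) auto
    finally show "\<exists>z\<in>UNIV. ereal (1 - e) \<le> norm_f_V' V z"
      by (auto simp: norm_f'_eq_if_V3[OF V3] max_def intro!: exI[of _ z])
  qed
qed

lemma SUP_norm_g_f: "(SUP z. norm_g_f_V V z) = 1"
proof (rule antisym)
  show "(SUP z. norm_g_f_V V z) \<le> 1"
    using F_pos F_less_1 by (intro SUP_least) (auto simp: norm_g_f_eq less_imp_le)
  show "1 \<le> (SUP z. norm_g_f_V V z)"
    unfolding one_ereal_def
  proof (rule ereal_le_SUP_if_approx)
    fix e :: real
    assume "0 < e"
    then have "\<forall>\<^sub>F z in at_top. 1 - e < F z"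
      using F_at_top by (intro order_tendstoD(1)) auto
    then obtain z where "1 - e < F z"
      by (auto simp: eventually_at_top_linorder)
    then show "\<exists>z\<in>UNIV. ereal (1 - e) \<le> norm_g_f_V V z"
      by (auto simp: norm_g_f_eq le_max_iff_disj intro!: exI[of _ z])
  qed
qed

section \<open>The exact constant when \<open>K\<close> changes sign once\<close>

text \<open>
  \<open>D = p - 4 p\<^sub>0 F (1 - F)\<close> vanishes at \<open>0\<close> and at \<open>\<infinity>\<close> and has derivative \<open>p K\<close>, so the sign
  pattern of \<open>K\<close> forces \<open>D \<ge> 0\<close> on the positive half-line.
\<close>

lemma C_K_eq_if_single_sign_change:
  assumes x0: "0 < x0" and pos: "\<And>x. 0 < x \<Longrightarrow> x < x0 \<Longrightarrow> 0 < K_V V x" and "K_V V x0 = 0"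
    and neg: "\<And>x. x0 < x \<Longrightarrow> K_V V x < 0"
  shows "C_K V = ereal (1 / (4 * p 0))"
proof (rule antisym[OF _ C_K_lower], rule C_K_le)
  fix z :: real
  assume z: "0 \<le> z"
  define D where "D x = p x - 4 * p 0 * (F x * (1 - F x))" for x
  have D_DERIV: "(D has_real_derivative p x * K_V V x) (at x)" for x
    unfolding D_def K_V_def
    by (auto intro!: derivative_eq_intros p_DERIV F_DERIV simp: algebra_simps)
  have K_nonneg: "0 \<le> K_V V x" if "0 \<le> x" "x \<le> x0" for x
  proof -
    \<comment> \<open>The sign assumption covers only the open interval; both endpoints are zeros of
      \<open>K\<close>.\<close>
    have "K_V V 0 = 0"
      by (simp add: K_V_def F_0 g_0)
    then show ?thesis
      using that pos[of x] assms(3) by (cases "x = 0"; cases "x = x0") auto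
  qed
  have "0 \<le> D z"
  proof (cases "z \<le> x0")
    case True
    have "D 0 \<le> D z"
      by (rule DERIV_nonneg_imp_nondecreasing[OF z])
         (use True D_DERIV K_nonneg p_pos in \<open>meson less_imp_le mult_nonneg_nonneg order_trans\<close>)
    then show ?thesis
      by (simp add: D_def F_0)
  next
    case False
    show ?thesis
    proof (rule nonneg_if_DERIV_nonpos_at_top[where f = D])
      have "(p \<longlongrightarrow> 0) at_top"
        using p_at_bot by (simp add: filterlim_at_bot_mirror p_minus)
      then have "(D \<longlongrightarrow> 0 - 4 * p 0 * (1 * (1 - 1))) at_top"
        unfolding D_def by (intro tendsto_intros F_at_top)
      then show "(D \<longlongrightarrow> 0) at_top"
        by simp
      fix t
      assume "z \<le> t"
      then have "p t * K_V V t \<le> 0"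
        using neg[of t] False p_pos[of t] by (simp add: mult_nonneg_nonpos)
      then show "\<exists>y. (D has_real_derivative y) (at t) \<and> y \<le> 0"
        using D_DERIV by blast
    qed
  qed
  then show "F z * F (- z) / p z \<le> 1 / (4 * p 0)"
    using p_pos[of 0] p_pos[of z] by (simp add: D_def F_minus field_simps)
qed

end

theorem theorem6p4:
  fixes V :: "real \<Rightarrow> real"
  assumes "cond_V1 V" and "cond_V2 V"
  shows
    "((\<forall>z. norm_f_V' V z \<le> 1 \<and>
           norm_g_f_V V z \<le> ereal (max (F_V V z) (1 - F_V V z)) \<and>
           max (F_V V z) (1 - F_V V z) \<le> 1) \<and>
      (\<forall>a>0. ereal (1 / (4 * p_V V 0)) \<le> C_K V \<and>
             C_K V \<le> ereal (max (exp (V a) / (4 * p_V V 0)) (1 / deriv V a))) \<and>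
      C_K V \<le> B_V V \<and> B_V V < \<infinity>)
     \<and>
     (cond_V3 V \<longrightarrow>
      (\<forall>z. mono (\<lambda>x. deriv V x * f_V V z x) \<and>
           norm_g_f_V V z = ereal (max (F_V V z) (1 - F_V V z)) \<and>
           norm_f_V' V z =
             ereal (max ((1 - F_V V z) * deriv (m_V V) z) (F_V V z * deriv (m_V V) (- z)))) \<and>
      (SUP z. norm_f_V' V z) = 1 \<and>
      (SUP z. norm_g_f_V V z) = 1)
     \<and>
     ((\<exists>x0>0. (\<forall>x\<in>{0<..<x0}. K_V V x > 0) \<and> K_V V x0 = 0 \<and> (\<forall>x\<in>{x0<..}. K_V V x < 0)) \<longrightarrow>
      C_K V = ereal (1 / (4 * p_V V 0)))"
proof -
  interpret stein_kernel V
    using assms by unfold_locales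
  have "max (F z) (1 - F z) \<le> 1" for z
    using F_pos[of z] F_less_1[of z] by simp
  moreover have "C_K V = ereal (1 / (4 * p 0))"
    if "\<exists>x0>0. (\<forall>x\<in>{0<..<x0}. K_V V x > 0) \<and> K_V V x0 = 0 \<and> (\<forall>x\<in>{x0<..}. K_V V x < 0)"
    using that C_K_eq_if_single_sign_change by auto
  ultimately show ?thesis
    using norm_f'_le_1 C_K_lower C_K_upper C_K_le_B B_finite g_f_mono_if_V3 SUP_norm_f'_if_V3
      SUP_norm_g_f
    by (simp add: norm_g_f_eq norm_f'_eq_if_V3 deriv_m)
qed

end
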